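(* For any $n\geq 3$ we have $\theta(C_n)=\lfloor\frac n2\rfloor+2$.
   Context: $C_n$ is the cycle on $n$ vertices. A vertex coloring of a graph $G$ (not necessarily proper) is distinguishing if the only automorphism of $G$ preserving the color of every vertex is the identity. The distinguishing threshold $\theta(G)$ is the minimum positive integer $t$ such that for every $k\geq t$, every coloring of $G$ with exactly $k$ colors (all $k$ used) is distinguishing. *)

theory Defs
  imports "Graph_Theory.Pair_Digraph" "Graph_Theory.Digraph_Isomorphism"
begin

text \<open>
  As in the library, simple undirected graphs are symmetric loopfree digraphs without parallel
  arcs (locale \<^locale>\<open>pair_graph\<close>): an edge $uv$ is the pair of arcs $(u,v)$, $(v,u)$.
\<close>

definition graph_automorphism :: "'a pair_pre_digraph \<Rightarrow> ('a \<Rightarrow> 'a) \<Rightarrow> bool" where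
  "graph_automorphism G f \<longleftrightarrow>
     bij_betw f (pverts G) (pverts G) \<and>
     (\<forall>u\<in>pverts G. \<forall>v\<in>pverts G. (u, v) \<in> parcs G \<longleftrightarrow> (f u, f v) \<in> parcs G)"

text \<open>
  An automorphism is a function on the whole type, but only its values on the vertices matter, so
  being the identity is required on vertices only.
\<close>

definition distinguishing :: "'a pair_pre_digraph \<Rightarrow> ('a \<Rightarrow> 'c) \<Rightarrow> bool" where
  "distinguishing G c \<longleftrightarrow>
     (\<forall>f. graph_automorphism G f \<and> (\<forall>v\<in>pverts G. c (f v) = c v) \<longrightarrow>
          (\<forall>v\<in>pverts G. f v = v))"

definition coloring_with :: "'a pair_pre_digraph \<Rightarrow> nat \<Rightarrow> ('a \<Rightarrow> nat) \<Rightarrow> bool" where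
  "coloring_with G k c \<longleftrightarrow> c ` pverts G = {1..k}"

definition threshold_bound :: "'a pair_pre_digraph \<Rightarrow> nat \<Rightarrow> bool" where
  "threshold_bound G t \<longleftrightarrow>
     0 < t \<and> (\<forall>k\<ge>t. \<forall>c. coloring_with G k c \<longrightarrow> distinguishing G c)"

definition distinguishing_threshold :: "'a pair_pre_digraph \<Rightarrow> nat" where
  "distinguishing_threshold G = (LEAST t. threshold_bound G t)"

text \<open>The cycle $C_n$ on the vertices $0, \dots, n-1$; meant for $n \ge 3$.\<close>

definition cycle_graph :: "nat \<Rightarrow> nat pair_pre_digraph" where
  "cycle_graph n =
     \<lparr> pverts = {..<n},
       parcs = {(i, j). i < n \<and> j < n \<and> (j = (i + 1) mod n \<or> i = (j + 1) mod n)} \<rparr>"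

lemma pair_graph_cycle_graph:
  assumes "n \<ge> 3"
  shows "pair_graph (cycle_graph n)"
proof -
  have "finite (parcs (cycle_graph n))"
    by (rule finite_subset[of _ "{..<n} \<times> {..<n}"]) (auto simp: cycle_graph_def)
  moreover have "i \<noteq> Suc i mod n" "Suc i mod n \<noteq> i" if "i < n" for i
    using that assms by (cases "Suc i = n"; auto)+
  ultimately show ?thesis
    by unfold_locales (auto simp: cycle_graph_def symmetric_def sym_def)
qed

text \<open>Agreement with the library's isomorphisms, which also record the map on arcs.\<close>

lemma graph_automorphism_iff_digraph_isomorphism:
  assumes "pair_wf_digraph G"
  shows "graph_automorphism G f \<longleftrightarrow>
    (\<exists>hom. pre_digraph.digraph_isomorphism (with_proj G) hom \<and>
           app_iso hom (with_proj G) = with_proj G \<and> iso_verts hom = f)"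
    (is "?L \<longleftrightarrow> ?R")
proof
  interpret pair_wf_digraph G by fact
  have wf: "wf_digraph (with_proj G)" using assms by (simp add: wf_digraph_wp_iff)
  assume ?L
  then have bij: "bij_betw f (pverts G) (pverts G)"
    and adj: "\<And>u v. u \<in> pverts G \<Longrightarrow> v \<in> pverts G \<Longrightarrow>
      (u, v) \<in> parcs G \<longleftrightarrow> (f u, f v) \<in> parcs G"
    by (auto simp: graph_automorphism_def)
  have inj: "inj_on f (pverts G)" and im: "f ` pverts G = pverts G"
    using bij by (auto simp: bij_betw_def)
  have "map_prod f f ` parcs G = parcs G"
  proof
    show "map_prod f f ` parcs G \<subseteq> parcs G"
    proof
      fix e assume "e \<in> map_prod f f ` parcs G"
      then obtain u v where "(u, v) \<in> parcs G" "e = (f u, f v)" by auto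
      then show "e \<in> parcs G" using adj[of u v] wellformed'[of u v] by blast
    qed
    show "parcs G \<subseteq> map_prod f f ` parcs G"
    proof
      fix e assume e: "e \<in> parcs G"
      obtain a b where ab: "e = (a, b)" by (cases e)
      with e have "a \<in> f ` pverts G" "b \<in> f ` pverts G" using im wellformed' by auto
      then obtain u v where uv: "a = f u" "b = f v" "u \<in> pverts G" "v \<in> pverts G" by auto
      then have "(u, v) \<in> parcs G" using adj[of u v] e ab by blast
      then show "e \<in> map_prod f f ` parcs G" using ab uv by (force intro: rev_image_eqI)
    qed
  qed
  moreover have "inj_on (map_prod f f) (parcs G)"
    using inj wellformed' by (auto simp: inj_on_def)
  ultimately show ?R
    using inj im wf
    by (intro exI[of _ "\<lparr>iso_verts = f, iso_arcs = map_prod f f, iso_head = snd, iso_tail = fst\<rparr>"])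
       (auto simp: pre_digraph.digraph_isomorphism_def app_iso_def with_proj_def)
next
  interpret pair_wf_digraph G by fact
  assume ?R
  then obtain hom where hom: "pre_digraph.digraph_isomorphism (with_proj G) hom"
    "app_iso hom (with_proj G) = with_proj G" "iso_verts hom = f" by auto
  have im: "f ` pverts G = pverts G" and arcs: "iso_arcs hom ` parcs G = parcs G"
    and ht: "iso_head hom = snd" "iso_tail hom = fst"
    using hom(2,3) by (auto simp: app_iso_def with_proj_def)
  have inj: "inj_on f (pverts G)"
    and "\<forall>a\<in>parcs G. f (fst a) = fst (iso_arcs hom a) \<and> f (snd a) = snd (iso_arcs hom a)"
    using hom(1,3) ht by (auto simp: pre_digraph.digraph_isomorphism_def with_proj_def)
  then have arc: "iso_arcs hom a = (f (fst a), f (snd a))" if "a \<in> parcs G" for a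
    using that by (metis prod.collapse)
  have "(u, v) \<in> parcs G \<longleftrightarrow> (f u, f v) \<in> parcs G"
    if uv: "u \<in> pverts G" "v \<in> pverts G" for u v
  proof
    assume "(u, v) \<in> parcs G"
    then show "(f u, f v) \<in> parcs G"
      using arc[of "(u, v)"] arcs imageI[of "(u, v)" "parcs G" "iso_arcs hom"] by simp
  next
    assume "(f u, f v) \<in> parcs G"
    then obtain a where a: "a \<in> parcs G" "(f u, f v) = iso_arcs hom a" using arcs by blast
    then have "f u = f (fst a)" "f v = f (snd a)" using arc by auto
    then have "u = fst a" "v = snd a"
      using inj uv a(1) arc_fst_in_verts arc_snd_in_verts by (auto dest: inj_onD)
    then show "(u, v) \<in> parcs G" using a(1) by simp
  qed
  then show ?L using inj im by (auto simp: graph_automorphism_def bij_betw_def)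
qed

text \<open>The minimum in the definition of the threshold exists for every finite graph.\<close>

lemma threshold_bound_distinguishing_threshold:
  assumes "finite (pverts G)"
  shows "threshold_bound G (distinguishing_threshold G)"
proof -
  have "k \<le> card (pverts G)" if "coloring_with G k c" for k c
    using card_image_le[OF assms, of c] that by (simp add: coloring_with_def)
  then have "threshold_bound G (Suc (card (pverts G)))"
    unfolding threshold_bound_def by (metis Suc_n_not_le_n le_trans zero_less_Suc)
  then show ?thesis unfolding distinguishing_threshold_def by (rule LeastI)
qed

end

theory Submission
  imports Defs "HOL-Number_Theory.Cong"
begin

text \<open>
  The theorem says that a coloring of $C_n$ that some nontrivial automorphism preserves has at most
  $\lfloor n/2 \rfloor + 1$ colors, and that this many colors do occur.

  For the upper bound, a color-preserving map sends each vertex to a vertex of the same color.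
  So a color class without a fixed point has at least two vertices, and the number of colors
  is at most $(n + F)/2$, where $F$ is the number of fixed points
  (\<open>card_invariant_image_le\<close>). It remains to see that $F \le 2$
  unless the automorphism is the identity. Walking around the cycle, an automorphism
  cannot turn back by injectivity, so it has the form $i \mapsto a + i$ or $i \mapsto a - i$ modulo
  $n$ (\<open>cycle_automorphism_affine\<close>). A rotation with a fixed point is the identity;
  a fixed point of a reflection satisfies $2i \equiv a$, which has at most two solutions with
  $0 \le i < n$ (\<open>card_fixed_points_cycle_automorphism\<close>).

  For the lower bound, color each vertex by its distance to the vertex $0$. This coloring
  has $\lfloor n/2 \rfloor + 1$ colors, and the reflection $i \mapsto -i$ preserves it.
\<close>

text \<open>
  Charge each color with the vertices of its class and once more with the fixed points among
  them. Every charge is at least two: a vertex of the class is either fixed, hence counted twice,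
  or has a different image in the same class. Summing the charges gives the right-hand side.
\<close>

lemma card_invariant_image_le:
  assumes "finite V" and maps: "\<And>v. v \<in> V \<Longrightarrow> f v \<in> V"
    and inv: "\<And>v. v \<in> V \<Longrightarrow> c (f v) = c v"
  shows "2 * card (c ` V) \<le> card V + card {v \<in> V. f v = v}"
proof -
  let ?F = "{v \<in> V. f v = v}"
  have split: "card W = (\<Sum>k\<in>c ` V. card {v \<in> W. c v = k})" if "W \<subseteq> V" for W
    using sum.group[of W "c ` V" c "\<lambda>_. 1::nat"] finite_subset[OF that] that \<open>finite V\<close>
    by (simp add: image_mono)
  have "2 \<le> card {v \<in> V. c v = k} + card {v \<in> ?F. c v = k}" if "k \<in> c ` V" for k
  proof -
    from that obtain v where v: "v \<in> V" "c v = k" by auto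
    show ?thesis
    proof (cases "f v = v")
      case True
      then have "card {v} \<le> card {v \<in> V. c v = k}" "card {v} \<le> card {v \<in> ?F. c v = k}"
        using v \<open>finite V\<close> by (intro card_mono; auto)+
      then show ?thesis by simp
    next
      case False
      have "card {v, f v} \<le> card {v \<in> V. c v = k}"
        using v \<open>finite V\<close> maps inv by (intro card_mono) auto
      then show ?thesis using False by simp
    qed
  qed
  then have "(\<Sum>k\<in>c ` V. 2) \<le> (\<Sum>k\<in>c ` V. card {v \<in> V. c v = k} + card {v \<in> ?F. c v = k})"
    by (rule sum_mono)
  then show ?thesis
    using split[of V] split[of ?F] by (simp add: sum.distrib)
qed

lemma cycle_automorphism_less:
  assumes "graph_automorphism (cycle_graph n) f" "i < n"
  shows "f i < n"
  using assms by (auto simp: graph_automorphism_def cycle_graph_def bij_betw_def)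

lemma cycle_automorphism_step:
  assumes "graph_automorphism (cycle_graph n) f" "Suc i < n"
  shows "[int (f (Suc i)) = int (f i) + 1] (mod int n) \<or>
         [int (f (Suc i)) = int (f i) - 1] (mod int n)"
proof -
  have "(i, Suc i) \<in> parcs (cycle_graph n)"
    using assms(2) by (simp add: cycle_graph_def)
  moreover have "i \<in> pverts (cycle_graph n)" "Suc i \<in> pverts (cycle_graph n)"
    using assms(2) by (simp_all add: cycle_graph_def)
  ultimately have "(f i, f (Suc i)) \<in> parcs (cycle_graph n)"
    using assms(1) unfolding graph_automorphism_def by blast
  then consider "f (Suc i) = (f i + 1) mod n" | "f i = (f (Suc i) + 1) mod n"
    by (auto simp: cycle_graph_def)
  then show ?thesis
  proof cases
    case 1
    then show ?thesis by (simp add: cong_def zmod_int add.commute)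
  next
    case 2
    then have "[int (f i) = int (f (Suc i)) + 1] (mod int n)"
      by (simp add: cong_def zmod_int add.commute)
    then have "[int (f i) - 1 = int (f (Suc i)) + 1 - 1] (mod int n)"
      by (rule cong_diff) simp
    then show ?thesis by (simp add: cong_sym)
  qed
qed

text \<open>
  The first edge fixes the direction $d$; every later step goes the same way, for otherwise
  $f(i+2) = f(i)$.
\<close>

lemma cycle_automorphism_affine:
  assumes f: "graph_automorphism (cycle_graph n) f"
  obtains d :: int where "d = 1 \<or> d = -1"
    "\<And>i. i < n \<Longrightarrow> [int (f i) = int (f 0) + d * int i] (mod int n)"
proof -
  note lt = cycle_automorphism_less[OF f]
  have inj: "inj_on f {..<n}"
    using f by (auto simp: graph_automorphism_def cycle_graph_def bij_betw_def)
  obtain d :: int where d: "d = 1 \<or> d = -1"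
    and d0: "Suc 0 < n \<Longrightarrow> [int (f (Suc 0)) = int (f 0) + d] (mod int n)"
    using cycle_automorphism_step[OF f, of 0] by (metis diff_conv_add_uminus)
  have step: "[int (f (Suc i)) = int (f i) + d] (mod int n)" if "Suc i < n" for i
    using that
  proof (induction i)
    case 0
    then show ?case by (rule d0)
  next
    case (Suc i)
    then have IH: "[int (f (Suc i)) = int (f i) + d] (mod int n)" by simp
    show ?case
    proof (rule ccontr)
      assume "\<not> ?thesis"
      then have "[int (f (Suc (Suc i))) = int (f (Suc i)) - d] (mod int n)"
        using cycle_automorphism_step[OF f Suc.prems] d by auto
      also have "[int (f (Suc i)) - d = int (f i) + d - d] (mod int n)"
        using IH by (rule cong_diff) simp
      finally have "[f (Suc (Suc i)) = f i] (mod n)"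
        by (simp add: cong_int_iff)
      then have "f (Suc (Suc i)) = f i"
        using lt Suc.prems by (simp add: cong_less_modulus_unique_nat)
      then show False using inj Suc.prems by (auto dest: inj_onD)
    qed
  qed
  have "[int (f i) = int (f 0) + d * int i] (mod int n)" if "i < n" for i
    using that
  proof (induction i)
    case (Suc i)
    have "[int (f (Suc i)) = int (f i) + d] (mod int n)" using Suc.prems by (rule step)
    also have "[int (f i) + d = int (f 0) + d * int i + d] (mod int n)"
      using Suc by (intro cong_add) auto
    finally show ?case by (simp add: algebra_simps)
  qed simp
  with d show ?thesis by (rule that)
qed

lemma card_fixed_points_cycle_automorphism:
  assumes f: "graph_automorphism (cycle_graph n) f" and "v < n" "f v \<noteq> v"
  shows "card {i \<in> {..<n}. f i = i} \<le> 2"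
proof -
  note lt = cycle_automorphism_less[OF f]
  obtain d :: int where d: "d = 1 \<or> d = -1"
    and aff: "\<And>i. i < n \<Longrightarrow> [int (f i) = int (f 0) + d * int i] (mod int n)"
    using cycle_automorphism_affine[OF f] by blast
  have sol: "i \<in> {f 0 div 2, (f 0 + n) div 2}" if "i < n" "f i = i" for i
  proof (cases "d = 1")
    \<comment> \<open>A rotation with a fixed point has $f(0) \equiv 0$, so it also fixes $v$.\<close>
    case True
    then have "[int i = int (f 0) + int i] (mod int n)" using aff[OF \<open>i < n\<close>] that by simp
    then have "[0 = int (f 0)] (mod int n)"
      by (metis add.left_neutral cong_add_rcancel)
    then have "[int (f 0) + int v = 0 + int v] (mod int n)"
      by (intro cong_add) (auto intro: cong_sym)
    with aff[OF \<open>v < n\<close>] True have "[int (f v) = int v] (mod int n)"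
      by (auto intro: cong_trans)
    then have "f v = v"
      using lt \<open>v < n\<close> by (simp add: cong_int_iff cong_less_modulus_unique_nat)
    with \<open>f v \<noteq> v\<close> show ?thesis by simp
  next
    case False
    then have "[int i = int (f 0) - int i] (mod int n)" using aff[OF \<open>i < n\<close>] that d by simp
    then have "[int i + int i = int (f 0) - int i + int i] (mod int n)" by (rule cong_add) simp
    then have "[int (2 * i) = int (f 0)] (mod int n)" by simp
    then have "2 * i mod n = f 0"
      using lt[of 0] \<open>i < n\<close> by (simp only: cong_int_iff) (simp add: cong_def)
    then have "2 * i = f 0 \<or> 2 * i = f 0 + n"
      using \<open>i < n\<close> by (cases "2 * i < n") (auto simp: le_mod_geq)
    then show ?thesis by auto
  qed
  have "card {i \<in> {..<n}. f i = i} \<le> card {f 0 div 2, (f 0 + n) div 2}"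
    using sol by (intro card_mono) auto
  also have "\<dots> \<le> 2" by (simp add: card_insert_if)
  finally show ?thesis .
qed

lemma threshold_bound_cycle_graph: "threshold_bound (cycle_graph n) (n div 2 + 2)"
proof -
  have "distinguishing (cycle_graph n) c"
    if "n div 2 + 2 \<le> k" "coloring_with (cycle_graph n) k c" for k and c :: "nat \<Rightarrow> nat"
  proof (rule ccontr)
    assume "\<not> ?thesis"
    then obtain f v where f: "graph_automorphism (cycle_graph n) f"
      and inv: "\<And>u. u < n \<Longrightarrow> c (f u) = c u" and v: "v < n" "f v \<noteq> v"
      by (auto simp: distinguishing_def cycle_graph_def)
    note lt = cycle_automorphism_less[OF f]
    have "c ` {..<n} = {1..k}"
      using that(2) by (simp add: coloring_with_def cycle_graph_def)
    then have "k = card (c ` {..<n})" by simp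
    then have "2 * k \<le> n + card {i \<in> {..<n}. f i = i}"
      using card_invariant_image_le[of "{..<n}" f c] lt inv by simp
    with card_fixed_points_cycle_automorphism[OF f v] that(1) show False by linarith
  qed
  then show ?thesis by (auto simp: threshold_bound_def)
qed

lemma graph_automorphism_reflection:
  "graph_automorphism (cycle_graph n) (\<lambda>i. if i = 0 then 0 else n - i)"
proof -
  let ?r = "\<lambda>i. if i = 0 then 0 else n - i"
  have verts: "pverts (cycle_graph n) = {..<n}" by (simp add: cycle_graph_def)
  have "bij_betw ?r {..<n} {..<n}"
    by (rule bij_betwI[where g = ?r]) auto
  moreover have "(u, v) \<in> parcs (cycle_graph n) \<longleftrightarrow> (?r u, ?r v) \<in> parcs (cycle_graph n)"
    if "u < n" "v < n" for u v
  proof -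
    have adj: "(i, j) \<in> parcs (cycle_graph n) \<longleftrightarrow>
        j = i + 1 \<or> i = j + 1 \<or> i = 0 \<and> j + 1 = n \<or> j = 0 \<and> i + 1 = n"
      if "i < n" "j < n" for i j
      using that by (cases "i + 1 = n"; cases "j + 1 = n") (auto simp: cycle_graph_def)
    have r: "?r u < n" "?r v < n" using that by auto
    show ?thesis
      unfolding adj[OF that] adj[OF r] using that
      by (cases "u = 0"; cases "v = 0") (simp_all, linarith+)
  qed
  ultimately show ?thesis
    unfolding graph_automorphism_def by (metis lessThan_iff verts)
qed

text \<open>
  The distance to $0$ takes the values $0, \dots, \lfloor n/2 \rfloor$; it is shifted by one
  because colors are counted from $1$.
\<close>

lemma coloring_with_distance:
  assumes "0 < n"
  shows "coloring_with (cycle_graph n) (n div 2 + 1) (\<lambda>i. min i (n - i) + 1)"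
proof -
  have "k \<in> (\<lambda>i. min i (n - i) + 1) ` {..<n}" if "k \<in> {1..n div 2 + 1}" for k
    using that assms by (intro image_eqI[where x = "k - 1"]) auto
  then show ?thesis
    by (auto simp: coloring_with_def cycle_graph_def)
qed

theorem proposition3p3:
  fixes n :: nat
  assumes "n \<ge> 3"
  shows "distinguishing_threshold (cycle_graph n) = n div 2 + 2"
  unfolding distinguishing_threshold_def
proof (rule Least_equality)
  show "threshold_bound (cycle_graph n) (n div 2 + 2)"
    by (rule threshold_bound_cycle_graph)
next
  fix t
  assume t: "threshold_bound (cycle_graph n) t"
  let ?c = "\<lambda>i. min i (n - i) + 1" and ?r = "\<lambda>i. if i = 0 then 0 else n - i"
  have "\<forall>v\<in>pverts (cycle_graph n). ?c (?r v) = ?c v"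
    by (auto simp: cycle_graph_def)
  \<comment> \<open>The reflection moves the vertex $1$ because $n \ge 3$.\<close>
  moreover have "1 \<in> pverts (cycle_graph n)" "?r 1 \<noteq> 1"
    using assms by (auto simp: cycle_graph_def)
  ultimately have "\<not> distinguishing (cycle_graph n) ?c"
    using graph_automorphism_reflection[of n] unfolding distinguishing_def by blast
  moreover have "coloring_with (cycle_graph n) (n div 2 + 1) ?c"
    using assms by (intro coloring_with_distance) simp
  ultimately have "\<not> t \<le> n div 2 + 1"
    using t unfolding threshold_bound_def by blast
  then show "n div 2 + 2 \<le> t" by simp
qed

end
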